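(* Let $N\ge 1$ and let $\mathcal{A}$ be the algebra with generators $x_1,\dots,x_N,p_1,\dots,p_N$ defined in the context, with $\Delta=\sum_{i=1}^N p_i^2$ and $|x|^2=\sum_{i=1}^N x_i^2$. The set of elements of $\mathcal{A}$ which are quadratic in the generators $x_1,\dots,x_N,p_1,\dots,p_N$ and which commute with both $\Delta$ and $|x|^2$ is the linear span of the elements $$L_{ij}=x_ip_j-x_jp_i,\qquad C_{ij}=[p_i,x_j]=p_ix_j-x_jp_i\qquad (i,j\in\{1,\dots,N\}).$$
   Context: Let $\mathbb{K}$ be $\mathbb{R}$ or $\mathbb{C}$. $\mathcal{A}$ is the unital associative $\mathbb{K}$-algebra generated by $x_1,\dots,x_N,p_1,\dots,p_N$ subject to the relations, for all $i,j$, $$[x_i,x_j]=0,\quad [p_i,p_j]=0,\quad \Big[\tfrac12\sum_{i=1}^N p_i^2,\,x_j\Big]=p_j,\quad \Big[\tfrac12\sum_{i=1}^N x_i^2,\,p_j\Big]=-x_j,$$ where $[a,b]=ab-ba$. An element is called quadratic in the generators if it is of the form $\sum_{i,j}(a_{ij}x_ip_j+b_{ij}p_ix_j+c_{ij}x_ix_j+d_{ij}p_ip_j)$ with scalars $a_{ij},b_{ij},c_{ij},d_{ij}\in\mathbb{K}$. *)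

theory Defs
  imports Complex_Main "HOL-Library.Poly_Mapping"
begin

definition commutator :: "'a::ring \<Rightarrow> 'a \<Rightarrow> 'a" where
  "commutator a b = a * b - b * a"

inductive_set ideal_generated :: "'a::ring_1 set \<Rightarrow> 'a set" for R :: "'a set" where
  zero: "0 \<in> ideal_generated R"
| gen: "r \<in> R \<Longrightarrow> r \<in> ideal_generated R"
| add: "a \<in> ideal_generated R \<Longrightarrow> b \<in> ideal_generated R \<Longrightarrow> a + b \<in> ideal_generated R"
| left: "a \<in> ideal_generated R \<Longrightarrow> c * a \<in> ideal_generated R"
| right: "a \<in> ideal_generated R \<Longrightarrow> a * c \<in> ideal_generated R"

lemma ideal_generated_uminus:
  assumes "a \<in> ideal_generated R" shows "- a \<in> ideal_generated R"
  using ideal_generated.left[OF assms, of "-1"] by simp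

lemma ideal_generated_diff:
  assumes "a \<in> ideal_generated R" "b \<in> ideal_generated R"
  shows "a - b \<in> ideal_generated R"
  using ideal_generated.add[OF assms(1) ideal_generated_uminus[OF assms(2)]] by simp

text \<open>
  The free monoid, written additively because the product of \<^type>\<open>poly_mapping\<close> is the
  convolution over an additive (not necessarily commutative) monoid of exponents. Thus
  finitely supported functions on words form the free unital associative algebra.
\<close>

datatype 'g word = Word (letters: "'g list")

instantiation word :: (type) monoid_add
begin
definition zero_word :: "'g word" where "zero_word = Word []"
definition plus_word :: "'g word \<Rightarrow> 'g word \<Rightarrow> 'g word" where
  "plus_word u v = Word (letters u @ letters v)"
instance by standard (simp_all add: zero_word_def plus_word_def)
end

lemma word_zero_eq_plus_iff: "(0 :: 'g word) = u + v \<longleftrightarrow> u = 0 \<and> v = 0"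
  by (cases u; cases v) (auto simp: zero_word_def plus_word_def)

datatype 'n generator = GenX 'n | GenP 'n

type_synonym ('n, 'k) free_alg = "'n generator word \<Rightarrow>\<^sub>0 'k"

definition free_const :: "'k \<Rightarrow> ('n, 'k::field) free_alg" where
  "free_const c = Poly_Mapping.single 0 c"

definition free_x :: "'n \<Rightarrow> ('n, 'k::field) free_alg" where
  "free_x i = Poly_Mapping.single (Word [GenX i]) 1"

definition free_p :: "'n \<Rightarrow> ('n, 'k::field) free_alg" where
  "free_p i = Poly_Mapping.single (Word [GenP i]) 1"

lemma free_const_add: "free_const (a + b) = free_const a + free_const b"
  by (simp add: free_const_def single_add)

lemma free_const_mult: "free_const (a * b) = free_const a * free_const b"
  by (simp add: free_const_def mult_single)

lemma free_const_one [simp]: "free_const 1 = 1"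
  by (simp add: free_const_def)

lemma free_const_central: "free_const c * f = f * free_const c"
proof (induction f rule: update_induct)
  case const
  show ?case by simp
next
  case (update f a b)
  then have "Poly_Mapping.update a b f = f + Poly_Mapping.single a b"
    by (intro poly_mapping_eqI)
       (auto simp: lookup_update lookup_add lookup_single when_def not_in_keys_iff_lookup_eq_zero)
  moreover have "free_const c * Poly_Mapping.single a b = Poly_Mapping.single a b * free_const c"
    by (simp add: free_const_def mult_single mult.commute)
  ultimately show ?case
    using update by (simp add: distrib_left distrib_right)
qed

lemma lookup_mult_0:
  fixes f g :: "'g word \<Rightarrow>\<^sub>0 'k::semiring_0"
  shows "Poly_Mapping.lookup (f * g) 0 = Poly_Mapping.lookup f 0 * Poly_Mapping.lookup g 0"
proof -
  have "Poly_Mapping.lookup (f * g) 0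
      = (\<Sum>l. Poly_Mapping.lookup f l * (\<Sum>q. (Poly_Mapping.lookup g q when l = 0) when q = 0))"
    by (simp add: lookup_mult word_zero_eq_plus_iff when_when conj_commute)
  also have "\<dots> = (\<Sum>l. (Poly_Mapping.lookup f l * Poly_Mapping.lookup g 0) when l = 0)"
    by (simp add: mult_when)
  finally show ?thesis by simp
qed

text \<open>The index set \<open>{1, \<dots>, N}\<close> is an arbitrary finite (hence nonempty) type \<open>'n\<close>.\<close>

definition relators :: "('n::finite, 'k::field) free_alg set" where
  "relators =
     {commutator (free_x i) (free_x j) | i j. True}
   \<union> {commutator (free_p i) (free_p j) | i j. True}
   \<union> {commutator (free_const (1/2) * (\<Sum>i\<in>UNIV. free_p i ^ 2)) (free_x j) - free_p j | j. True}
   \<union> {commutator (free_const (1/2) * (\<Sum>i\<in>UNIV. free_x i ^ 2)) (free_p j) + free_x j | j. True}"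

definition alg_rel :: "('n::finite, 'k::field) free_alg \<Rightarrow> ('n, 'k) free_alg \<Rightarrow> bool" where
  "alg_rel f g \<longleftrightarrow> f - g \<in> ideal_generated relators"

lemma alg_rel_equivp: "equivp alg_rel"
proof (rule equivpI)
  show "reflp alg_rel"
    by (simp add: reflp_def alg_rel_def ideal_generated.zero)
  show "symp alg_rel"
    unfolding symp_def alg_rel_def using ideal_generated_uminus by fastforce
  show "transp alg_rel"
    unfolding transp_def alg_rel_def using ideal_generated.add by fastforce
qed

quotient_type (overloaded) ('n, 'k) alg = "('n::finite, 'k::field) free_alg" / alg_rel
  by (rule alg_rel_equivp)

lemma lookup_generator_0:
  "Poly_Mapping.lookup (free_x i) 0 = 0" "Poly_Mapping.lookup (free_p i) 0 = 0"
  by (simp_all add: free_x_def free_p_def lookup_single zero_word_def)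

lemma ideal_relators_lookup_0:
  assumes "f \<in> ideal_generated relators" shows "Poly_Mapping.lookup f 0 = 0"
  using assms
proof induction
  case (gen r)
  then show ?case
    by (auto simp: relators_def commutator_def lookup_add lookup_minus lookup_mult_0
        lookup_generator_0)
qed (simp_all add: lookup_add lookup_mult_0)

instantiation alg :: (finite, field) ring_1
begin

lift_definition zero_alg :: "('a, 'b) alg" is 0 .
lift_definition one_alg :: "('a, 'b) alg" is 1 .
lift_definition plus_alg :: "('a, 'b) alg \<Rightarrow> ('a, 'b) alg \<Rightarrow> ('a, 'b) alg" is "(+)"
  unfolding alg_rel_def using ideal_generated.add by (fastforce simp: algebra_simps)
lift_definition uminus_alg :: "('a, 'b) alg \<Rightarrow> ('a, 'b) alg" is uminus
  unfolding alg_rel_def using ideal_generated_uminus by fastforce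
lift_definition minus_alg :: "('a, 'b) alg \<Rightarrow> ('a, 'b) alg \<Rightarrow> ('a, 'b) alg" is "(-)"
  unfolding alg_rel_def using ideal_generated_diff by (fastforce simp: algebra_simps)
lift_definition times_alg :: "('a, 'b) alg \<Rightarrow> ('a, 'b) alg \<Rightarrow> ('a, 'b) alg" is "(*)"
proof -
  fix f f' g g' :: "('a, 'b) free_alg"
  assume "alg_rel f f'" "alg_rel g g'"
  then have "(f - f') * g + f' * (g - g') \<in> ideal_generated relators"
    unfolding alg_rel_def
    by (intro ideal_generated.add ideal_generated.left ideal_generated.right)
  then show "alg_rel (f * g) (f' * g')"
    by (simp add: alg_rel_def algebra_simps)
qed

instance
proof
  show "(0 :: ('a, 'b) alg) \<noteq> 1"
  proof transfer
    show "\<not> alg_rel (0 :: ('a, 'b) free_alg) 1"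
      unfolding alg_rel_def by (auto dest!: ideal_relators_lookup_0)
  qed
qed (transfer; simp add: alg_rel_def algebra_simps ideal_generated.zero)+

end

lift_definition scale_alg :: "'k \<Rightarrow> ('n::finite, 'k::field) alg \<Rightarrow> ('n, 'k) alg"  (infixr "*\<^sub>A" 75)
  is "\<lambda>c f. free_const c * f"
  unfolding alg_rel_def using ideal_generated.left
  by (fastforce simp flip: right_diff_distrib)

lift_definition gen_x :: "'n \<Rightarrow> ('n::finite, 'k::field) alg" is free_x .
lift_definition gen_p :: "'n \<Rightarrow> ('n::finite, 'k::field) alg" is free_p .

global_interpretation alg: vector_space scale_alg
  by standard (transfer;
    simp add: alg_rel_def algebra_simps free_const_add free_const_mult ideal_generated.zero)+

lemma scale_alg_mult_left: "(c *\<^sub>A a) * b = c *\<^sub>A (a * b)"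
  by transfer (simp add: alg_rel_def algebra_simps ideal_generated.zero)

lemma scale_alg_mult_right: "a * (c *\<^sub>A b) = c *\<^sub>A (a * b)"
proof transfer
  fix a b :: "('a, 'b) free_alg" and c
  have "a * (free_const c * b) = free_const c * (a * b)"
    by (metis free_const_central mult.assoc)
  then show "alg_rel (a * (free_const c * b)) (free_const c * (a * b))"
    by (simp add: alg_rel_def ideal_generated.zero)
qed

definition Laplacian :: "('n::finite, 'k::field) alg" where
  "Laplacian = (\<Sum>i\<in>UNIV. gen_p i ^ 2)"

definition norm_sq :: "('n::finite, 'k::field) alg" where
  "norm_sq = (\<Sum>i\<in>UNIV. gen_x i ^ 2)"

definition elem_L :: "'n \<Rightarrow> 'n \<Rightarrow> ('n::finite, 'k::field) alg" where
  "elem_L i j = gen_x i * gen_p j - gen_x j * gen_p i"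

definition elem_C :: "'n \<Rightarrow> 'n \<Rightarrow> ('n::finite, 'k::field) alg" where
  "elem_C i j = commutator (gen_p i) (gen_x j)"

definition quadratic :: "('n::finite, 'k::field) alg set" where
  "quadratic = {q. \<exists>a b c d :: 'n \<Rightarrow> 'n \<Rightarrow> 'k.
     q = (\<Sum>i\<in>UNIV. \<Sum>j\<in>UNIV. a i j *\<^sub>A (gen_x i * gen_p j) + b i j *\<^sub>A (gen_p i * gen_x j)
                              + c i j *\<^sub>A (gen_x i * gen_x j) + d i j *\<^sub>A (gen_p i * gen_p j))}"

lemma commutator_x_x: "commutator (gen_x i) (gen_x j) = (0 :: ('n::finite, 'k::field) alg)"
  unfolding commutator_def
  by transfer (auto simp: alg_rel_def relators_def commutator_def intro!: ideal_generated.gen)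

lemma commutator_p_p: "commutator (gen_p i) (gen_p j) = (0 :: ('n::finite, 'k::field) alg)"
  unfolding commutator_def
  by transfer (auto simp: alg_rel_def relators_def commutator_def intro!: ideal_generated.gen)

lemma Laplacian_rep:
  "Laplacian = abs_alg (\<Sum>i\<in>UNIV. free_p i ^ 2 :: ('n::finite, 'k::field) free_alg)"
proof -
  have "abs_alg (sum f A) = (\<Sum>i\<in>A. abs_alg (f i))"
    if "finite A" for A :: "'n set" and f :: "'n \<Rightarrow> ('n, 'k) free_alg"
    using that by induction (simp_all add: zero_alg_def plus_alg.abs_eq[symmetric])
  then show ?thesis
    by (simp add: Laplacian_def gen_p.abs_eq power2_eq_square times_alg.abs_eq)
qed

lemma norm_sq_rep:
  "norm_sq = abs_alg (\<Sum>i\<in>UNIV. free_x i ^ 2 :: ('n::finite, 'k::field) free_alg)"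
proof -
  have "abs_alg (sum f A) = (\<Sum>i\<in>A. abs_alg (f i))"
    if "finite A" for A :: "'n set" and f :: "'n \<Rightarrow> ('n, 'k) free_alg"
    using that by induction (simp_all add: zero_alg_def plus_alg.abs_eq[symmetric])
  then show ?thesis
    by (simp add: norm_sq_def gen_x.abs_eq power2_eq_square times_alg.abs_eq)
qed

lemma commutator_Laplacian_x: "commutator ((1/2) *\<^sub>A Laplacian) (gen_x j) = gen_p j"
  unfolding commutator_def Laplacian_rep scale_alg.abs_eq gen_x.abs_eq gen_p.abs_eq
    times_alg.abs_eq minus_alg.abs_eq alg.abs_eq_iff alg_rel_def
  by (rule ideal_generated.gen) (auto simp: relators_def commutator_def)

lemma commutator_norm_sq_p: "commutator ((1/2) *\<^sub>A norm_sq) (gen_p j) = - gen_x j"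
  unfolding commutator_def norm_sq_rep scale_alg.abs_eq gen_x.abs_eq gen_p.abs_eq uminus_alg.abs_eq
    times_alg.abs_eq minus_alg.abs_eq alg.abs_eq_iff alg_rel_def
  by (rule ideal_generated.gen) (auto simp: relators_def commutator_def)

end

theory Submission
  imports Defs
begin

text \<open>
  The derivations \<open>E = [\<Delta>/2, \<cdot>]\<close> and \<open>F = [|x|\<^sup>2/2, \<cdot>]\<close> act on the generators by \<open>x \<mapsto> p \<mapsto> 0\<close> and
  \<open>p \<mapsto> -x \<mapsto> 0\<close>, so the quadratic elements form a quotient of \<open>N\<^sup>2\<close> copies of the tensor square of
  the standard representation of \<open>sl\<^sub>2\<close>, and the claim identifies its invariants. Concretely, let
  \<open>q = XP a + PX b + XX c + PP d\<close>, where \<open>XP a = \<Sum> a\<^sub>i\<^sub>j x\<^sub>i p\<^sub>j\<close> and so on,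
  be killed by \<open>E\<close> and \<open>F\<close>. Then \<open>F\<^sup>2 q = 2 XX d\<close> and
  \<open>E\<^sup>2 q = 2 PP c\<close> vanish, whence also \<open>PP d = XX c = 0\<close>. Now \<open>E F q = 0\<close> says that the symmetric
  part \<open>XP (a + b) + PX (a + b)\<close> is zero, and \<open>2 q = XP (a - b) - PX (a - b)\<close> is a combination of
  \<open>x\<^sub>i p\<^sub>j - p\<^sub>i x\<^sub>j = L\<^sub>i\<^sub>j - C\<^sub>i\<^sub>j\<close>. No linear independence of the quadratic monomials is needed.
\<close>

section \<open>Commutators as derivations\<close>

lemma commutator_add_right: "commutator a (b + c) = commutator a b + commutator a c"
  by (simp add: commutator_def algebra_simps)

lemma commutator_minus_right: "commutator a (- b) = - commutator a b"
  by (simp add: commutator_def)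

lemma commutator_diff_right: "commutator a (b - c) = commutator a b - commutator a c"
  by (simp add: commutator_def algebra_simps)

lemma commutator_zero_right [simp]: "commutator a 0 = 0"
  by (simp add: commutator_def)

lemma commutator_sum_right: "commutator a (sum f A) = (\<Sum>i\<in>A. commutator a (f i))"
  by (simp add: commutator_def sum_distrib_left sum_distrib_right sum_subtractf)

lemma commutator_sum_left: "commutator (sum f A) b = (\<Sum>i\<in>A. commutator (f i) b)"
  by (simp add: commutator_def sum_distrib_left sum_distrib_right sum_subtractf)

lemma commutator_mult_right:
  "commutator a (b * c) = commutator a b * c + b * commutator a c"
  by (simp add: commutator_def algebra_simps)

lemma commutator_mult_left:
  "commutator (a * b) c = a * commutator b c + commutator a c * b"
  by (simp add: commutator_def algebra_simps)

lemma commutator_swap: "commutator b a = - commutator a b"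
  by (simp add: commutator_def)

lemma commutator_scale_right: "commutator a (c *\<^sub>A b) = c *\<^sub>A commutator a b"
  by (simp add: commutator_def scale_alg_mult_left scale_alg_mult_right alg.scale_right_diff_distrib)

lemma commutator_scale_left: "commutator (c *\<^sub>A a) b = c *\<^sub>A commutator a b"
  by (simp add: commutator_def scale_alg_mult_left scale_alg_mult_right alg.scale_right_diff_distrib)

text \<open>Doubling is multiplication by the scalar 2, which is invertible in characteristic
  zero.\<close>

lemma alg_add_self_eq_0_iff:
  fixes a :: "('n::finite, 'k::field_char_0) alg"
  shows "a + a = 0 \<longleftrightarrow> a = 0"
proof -
  have "(2::'k) *\<^sub>A a = a + a"
    using alg.scale_left_distrib[of 1 1 a] by simp
  then show ?thesis
    by (metis alg.scale_eq_0_iff zero_neq_numeral)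
qed

section \<open>The two derivations and their action on the generators\<close>

definition half_Laplacian :: "('n::finite, 'k::field) alg" where
  "half_Laplacian = (1/2) *\<^sub>A Laplacian"

definition half_norm_sq :: "('n::finite, 'k::field) alg" where
  "half_norm_sq = (1/2) *\<^sub>A norm_sq"

text \<open>The factor 1/2 matches the defining relations; being nonzero, it leaves the kernel
  unchanged, and so does the sign from swapping the arguments.\<close>

lemma commutator_half_Laplacian_eq_0_iff:
  fixes q :: "('n::finite, 'k::field_char_0) alg"
  shows "commutator half_Laplacian q = 0 \<longleftrightarrow> commutator q Laplacian = 0"
  by (simp add: half_Laplacian_def commutator_scale_left commutator_swap[of q])

lemma commutator_half_norm_sq_eq_0_iff:
  fixes q :: "('n::finite, 'k::field_char_0) alg"
  shows "commutator half_norm_sq q = 0 \<longleftrightarrow> commutator q norm_sq = 0"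
  by (simp add: half_norm_sq_def commutator_scale_left commutator_swap[of q])

text \<open>The first equation is a defining relation; the second follows from the Leibniz rule on
  each \<open>gen_p k ^ 2\<close>, since the \<open>gen_p k\<close> commute.\<close>

lemma commutator_half_Laplacian_gen [simp]:
  "commutator half_Laplacian (gen_x i) = gen_p i"
  "commutator half_Laplacian (gen_p i) = 0"
  by (simp_all add: half_Laplacian_def commutator_Laplacian_x)
     (simp add: Laplacian_def commutator_scale_left commutator_sum_left power2_eq_square
        commutator_mult_left commutator_p_p)

lemma commutator_half_norm_sq_gen [simp]:
  "commutator half_norm_sq (gen_p i) = - gen_x i"
  "commutator half_norm_sq (gen_x i) = 0"
  by (simp_all add: half_norm_sq_def commutator_norm_sq_p)
     (simp add: norm_sq_def commutator_scale_left commutator_sum_left power2_eq_square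
        commutator_mult_left commutator_x_x)

section \<open>Quadratic expressions and their coefficient families\<close>

definition quad_form ::
  "('n \<Rightarrow> ('n::finite, 'k::field) alg) \<Rightarrow> ('n \<Rightarrow> ('n, 'k) alg) \<Rightarrow> ('n \<Rightarrow> 'n \<Rightarrow> 'k) \<Rightarrow> ('n, 'k) alg"
  where "quad_form u v f = (\<Sum>i\<in>UNIV. \<Sum>j\<in>UNIV. f i j *\<^sub>A (u i * v j))"

text \<open>This is the Leibniz rule. With \<open>u\<close> and \<open>v\<close> arbitrary families,
  it covers all four kinds of quadratic monomials at once.\<close>

lemma commutator_quad_form:
  "commutator a (quad_form u v f)
     = quad_form (\<lambda>i. commutator a (u i)) v f + quad_form u (\<lambda>i. commutator a (v i)) f"
  by (simp add: quad_form_def commutator_sum_right commutator_scale_right commutator_mult_right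
      alg.scale_right_distrib sum.distrib)

lemma quad_form_zero [simp]:
  "quad_form (\<lambda>_. 0) v f = 0" "quad_form u (\<lambda>_. 0) f = 0" "quad_form u v (\<lambda>_ _. 0) = 0"
  by (simp_all add: quad_form_def)

lemma quad_form_uminus [simp]:
  "quad_form (\<lambda>i. - u i) v f = - quad_form u v f"
  "quad_form u (\<lambda>i. - v i) f = - quad_form u v f"
  by (simp_all add: quad_form_def sum_negf)

lemma quad_form_add:
  "quad_form u v (\<lambda>i j. f i j + g i j) = quad_form u v f + quad_form u v g"
  by (simp add: quad_form_def alg.scale_left_distrib sum.distrib)

lemma quad_form_scale: "quad_form u v (\<lambda>i j. c * f i j) = c *\<^sub>A quad_form u v f"
  by (simp add: quad_form_def alg.scale_sum_right)

lemma quad_form_of_bool: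
  "quad_form u v (\<lambda>k l. of_bool (k = i \<and> l = j)) = u i * v j"
proof -
  \<comment> \<open>Nested conditionals let the double sum collapse one index at a time.\<close>
  have "of_bool (k = i \<and> l = j) *\<^sub>A (u k * v l)
      = (if k = i then if l = j then u k * v l else 0 else 0)" for k l
    by simp
  then have "quad_form u v (\<lambda>k l. of_bool (k = i \<and> l = j))
      = (\<Sum>k\<in>UNIV. if k = i then \<Sum>l\<in>UNIV. if l = j then u k * v l else 0 else 0)"
    unfolding quad_form_def by (intro sum.cong refl) simp
  also have "\<dots> = u i * v j" by simp
  finally show ?thesis .
qed

lemma quadratic_iff:
  "q \<in> quadratic \<longleftrightarrow> (\<exists>a b c d. q = quad_form gen_x gen_p a + quad_form gen_p gen_x b
                                  + quad_form gen_x gen_x c + quad_form gen_p gen_p d)"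
  by (simp add: quadratic_def quad_form_def sum.distrib)

lemma subspace_quadratic: "alg.subspace (quadratic :: ('n::finite, 'k::field) alg set)"
proof (rule alg.subspaceI)
  show "0 \<in> quadratic"
    unfolding quadratic_iff by (intro exI[of _ "\<lambda>_ _. 0"]) simp
next
  fix q r :: "('n, 'k) alg"
  assume "q \<in> quadratic" "r \<in> quadratic"
  then obtain a b c d a' b' c' d' where
    "q = quad_form gen_x gen_p a + quad_form gen_p gen_x b
       + quad_form gen_x gen_x c + quad_form gen_p gen_p d"
    "r = quad_form gen_x gen_p a' + quad_form gen_p gen_x b'
       + quad_form gen_x gen_x c' + quad_form gen_p gen_p d'"
    unfolding quadratic_iff by blast
  then have "q + r = quad_form gen_x gen_p (\<lambda>i j. a i j + a' i j)
      + quad_form gen_p gen_x (\<lambda>i j. b i j + b' i j)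
      + quad_form gen_x gen_x (\<lambda>i j. c i j + c' i j)
      + quad_form gen_p gen_p (\<lambda>i j. d i j + d' i j)"
    by (simp add: quad_form_add algebra_simps)
  then show "q + r \<in> quadratic"
    unfolding quadratic_iff by blast
next
  fix k and q :: "('n, 'k) alg"
  assume "q \<in> quadratic"
  then obtain a b c d where
    "q = quad_form gen_x gen_p a + quad_form gen_p gen_x b
       + quad_form gen_x gen_x c + quad_form gen_p gen_p d"
    unfolding quadratic_iff by blast
  then have "k *\<^sub>A q = quad_form gen_x gen_p (\<lambda>i j. k * a i j)
      + quad_form gen_p gen_x (\<lambda>i j. k * b i j)
      + quad_form gen_x gen_x (\<lambda>i j. k * c i j)
      + quad_form gen_p gen_p (\<lambda>i j. k * d i j)"
    by (simp add: quad_form_scale alg.scale_right_distrib)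
  then show "k *\<^sub>A q \<in> quadratic"
    unfolding quadratic_iff by blast
qed

lemma gen_mult_in_quadratic:
  "gen_x i * gen_p j \<in> quadratic" "gen_p i * gen_x j \<in> quadratic"
proof -
  let ?e = "\<lambda>k l. of_bool (k = i \<and> l = j)" and ?z = "\<lambda>_ _. 0"
  have "gen_x i * gen_p j = quad_form gen_x gen_p ?e + quad_form gen_p gen_x ?z
      + quad_form gen_x gen_x ?z + quad_form gen_p gen_p ?z"
    by (simp add: quad_form_of_bool)
  then show "gen_x i * gen_p j \<in> quadratic"
    unfolding quadratic_iff by blast
  have "gen_p i * gen_x j = quad_form gen_x gen_p ?z + quad_form gen_p gen_x ?e
      + quad_form gen_x gen_x ?z + quad_form gen_p gen_p ?z"
    by (simp add: quad_form_of_bool)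
  then show "gen_p i * gen_x j \<in> quadratic"
    unfolding quadratic_iff by blast
qed

section \<open>The two inclusions\<close>

lemma subspace_commutant: "alg.subspace {q. commutator a q = 0}"
  by (rule alg.subspaceI)
     (simp_all add: commutator_add_right commutator_scale_right)

lemma gen_x_commute: "gen_x i * gen_x j = gen_x j * gen_x i"
  using commutator_x_x[of i j] by (simp add: commutator_def)

lemma gen_p_commute: "gen_p i * gen_p j = gen_p j * gen_p i"
  using commutator_p_p[of i j] by (simp add: commutator_def)

text \<open>The right-hand side is a subspace, so the generators of the span suffice. On them the
  derivations give, up to sign, \<open>[p_i, p_j]\<close> or \<open>[x_i, x_j]\<close>, which
  vanish.\<close>

lemma span_LC_subset:
  "alg.span ({elem_L i j | i j. True} \<union> {elem_C i j | i j. True} :: ('n::finite, 'k::field) alg set)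
     \<subseteq> quadratic \<inter> {q. commutator half_Laplacian q = 0} \<inter> {q. commutator half_norm_sq q = 0}"
    (is "alg.span ?S \<subseteq> ?T")
proof (rule alg.span_minimal)
  have "elem_L i j \<in> (quadratic :: ('n, 'k) alg set)"
      "elem_C i j \<in> (quadratic :: ('n, 'k) alg set)" for i j
    unfolding elem_L_def elem_C_def commutator_def
    by (intro alg.subspace_diff subspace_quadratic gen_mult_in_quadratic)+
  moreover have "commutator half_Laplacian (elem_L i j :: ('n, 'k) alg) = 0"
      "commutator half_Laplacian (elem_C i j :: ('n, 'k) alg) = 0"
      "commutator half_norm_sq (elem_L i j :: ('n, 'k) alg) = 0"
      "commutator half_norm_sq (elem_C i j :: ('n, 'k) alg) = 0" for i j
    by (simp_all add: elem_L_def elem_C_def commutator_def[of "gen_p i" "gen_x j"] commutator_diff_right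
        commutator_mult_right gen_p_commute gen_x_commute)
  ultimately show "?S \<subseteq> ?T"
    by auto
qed (intro alg.subspace_inter subspace_quadratic subspace_commutant)

lemma invariant_quadratic_in_span_LC:
  fixes q :: "('n::finite, 'k::field_char_0) alg"
  assumes "q \<in> quadratic"
    and Eq: "commutator half_Laplacian q = 0" and Fq: "commutator half_norm_sq q = 0"
  shows "q \<in> alg.span ({elem_L i j | i j. True} \<union> {elem_C i j | i j. True})"
    (is "_ \<in> alg.span ?S")
proof -
  define E where "E = commutator (half_Laplacian :: ('n, 'k) alg)"
  define F where "F = commutator (half_norm_sq :: ('n, 'k) alg)"
  define XP PX XX PP :: "('n \<Rightarrow> 'n \<Rightarrow> 'k) \<Rightarrow> ('n, 'k) alg"
    where "XP = quad_form gen_x gen_p" and "PX = quad_form gen_p gen_x"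
      and "XX = quad_form gen_x gen_x" and "PP = quad_form gen_p gen_p"
  note forms = XP_def PX_def XX_def PP_def
  have E [simp]: "E 0 = 0" "E (y + z) = E y + E z" "E (- y) = - E y"
      "E (XP f) = PP f" "E (PX f) = PP f" "E (XX f) = PX f + XP f" "E (PP f) = 0" for y z f
    by (simp_all add: E_def forms commutator_add_right commutator_minus_right commutator_quad_form)
  have F [simp]: "F 0 = 0" "F (y + z) = F y + F z" "F (- y) = - F y"
      "F (XP f) = - XX f" "F (PX f) = - XX f" "F (PP f) = - XP f - PX f" "F (XX f) = 0" for y z f
    by (simp_all add: F_def forms commutator_add_right commutator_minus_right commutator_quad_form)
  have F_diff [simp]: "F (y - z) = F y - F z" for y z
    by (simp add: F_def commutator_diff_right)
  have E_diff [simp]: "E (y - z) = E y - E z" for y z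
    by (simp add: E_def commutator_diff_right)
  obtain a b c d where q: "q = XP a + PX b + XX c + PP d"
    using assms(1) unfolding quadratic_iff forms by blast
  have Eq: "E q = 0" and Fq: "F q = 0"
    using Eq Fq by (simp_all add: E_def F_def)
  have "F (F q) = XX d + XX d" and "E (E q) = PP c + PP c"
    unfolding q by simp_all
  then have "XX d = 0" and "PP c = 0"
    using Eq Fq by (simp_all add: alg_add_self_eq_0_iff)
  \<comment> \<open>These expressions also equal \<open>PP d + PP d\<close> and
    \<open>XX c + XX c\<close>, so the vanishing passes from one form to the other with the same
    coefficients.\<close>
  then have "E (E (XX d)) = 0" and "F (F (PP c)) = 0"
    by simp_all
  then have PP_d: "PP d = 0" and XX_c: "XX c = 0"
    by (simp_all add: alg_add_self_eq_0_iff)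
  \<comment> \<open>The \<open>c\<close> part dies under \<open>F\<close>; the \<open>d\<close> part
    contributes a multiple of \<open>PP d\<close>, which is zero.\<close>
  have "E (F q) = - (XP a + PX a + XP b + PX b)"
    unfolding q by (simp add: PP_d)
  then have sym: "XP a + PX a + XP b + PX b = 0"
    using Fq E(1) by (metis neg_equal_0_iff_equal)
  have "2 *\<^sub>A q = q + q"
    using alg.scale_left_distrib[of 1 1 q] by simp
  \<comment> \<open>Splitting off the vanishing symmetric sum: \<open>PX a\<close> and
    \<open>XP b\<close> cancel, while \<open>XP a\<close> and \<open>PX b\<close> are
    doubled.\<close>
  also have "\<dots> = (XP a - PX a) - (XP b - PX b) + (XP a + PX a + XP b + PX b)"
    by (simp add: q PP_d XX_c)
  finally have two_q: "2 *\<^sub>A q = (XP a - PX a) - (XP b - PX b)"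
    using sym by simp
  have anti: "XP f - PX f \<in> alg.span ?S" for f
  proof -
    \<comment> \<open>The term \<open>gen_x j * gen_p i\<close> occurs in both elements with the
      same sign and cancels.\<close>
    have LC: "elem_L i j - elem_C i j = gen_x i * gen_p j - gen_p i * gen_x j" for i j :: 'n
      by (simp add: elem_L_def elem_C_def commutator_def)
    have "XP f - PX f = (\<Sum>i\<in>UNIV. \<Sum>j\<in>UNIV. f i j *\<^sub>A (elem_L i j - elem_C i j))"
      by (simp add: forms quad_form_def alg.scale_right_diff_distrib sum_subtractf LC)
    also have "\<dots> \<in> alg.span ?S"
      by (intro alg.span_sum alg.span_scale alg.span_diff alg.span_base) auto
    finally show ?thesis .
  qed
  have "(1/2) *\<^sub>A (2 *\<^sub>A q) \<in> alg.span ?S"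
    unfolding two_q by (intro alg.span_scale alg.span_diff anti)
  then show ?thesis
    by simp
qed

lemma invariant_quadratics_eq_span_LC:
  "{q :: ('n::finite, 'k::field_char_0) alg. q \<in> quadratic
      \<and> commutator q Laplacian = 0 \<and> commutator q norm_sq = 0}
   = alg.span ({elem_L i j | i j. True} \<union> {elem_C i j | i j. True})"
  using span_LC_subset[where 'n='n and 'k='k] invariant_quadratic_in_span_LC[where 'n='n and 'k='k]
  unfolding commutator_half_Laplacian_eq_0_iff commutator_half_norm_sq_eq_0_iff by blast

theorem theorem2p3:
  shows "{q :: ('n::finite, real) alg. q \<in> quadratic
             \<and> commutator q Laplacian = 0 \<and> commutator q norm_sq = 0}
         = alg.span ({elem_L i j | i j. True} \<union> {elem_C i j | i j. True})
       \<and> {q :: ('n, complex) alg. q \<in> quadratic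
             \<and> commutator q Laplacian = 0 \<and> commutator q norm_sq = 0}
         = alg.span ({elem_L i j | i j. True} \<union> {elem_C i j | i j. True})"
  \<comment> \<open>The fact is given twice so that each copy takes its own scalar field,
    \<open>real\<close> or \<open>complex\<close>.\<close>
  using invariant_quadratics_eq_span_LC invariant_quadratics_eq_span_LC by (rule conjI)

end
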